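(* Let $\Gamma$ be a first-order expansion of $(\mathbb Q;f)$, where $f(a,b,c)=a-b+c$. Then either (i) each relation in $\Gamma$ has a quantifier-free Horn definition in $(\mathbb Q;f)$, or (ii) every non-empty relation of $\Gamma$ contains a tuple of the form $(0,\dots,0)$, or (iii) every relation first-order definable in $(\mathbb Q;f)$ has a primitive positive definition in $\Gamma$.
   Context: $(\mathbb Q;f)$ is the structure with domain $\mathbb Q$ and ternary operation $f(a,b,c)=a-b+c$. A first-order expansion of $(\mathbb Q;f)$ is a relational structure with domain $\mathbb Q$ whose relations include $\{(a,b,c,d)\mid a-b+c=d\}$ and are all first-order definable in $(\mathbb Q;f)$. A quantifier-free Horn definition in $(\mathbb Q;f)$ is a quantifier-free formula in conjunctive normal form, each clause containing at most one positive literal, with atoms of the form $f(x,y,z)=w$ or $x=y$. A primitive positive definition in $\Gamma$ is a formula $\exists x_1,\dots,x_n.\,\psi_1\wedge\dots\wedge\psi_m$ with each $\psi_i$ an atomic formula $x=y$ or $R(x_{i_1},\dots,x_{i_k})$ for a relation $R$ of $\Gamma$.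
   Formalization: Atoms in quantifier-free Horn definitions are equations between arbitrary terms built from f; if the arguments in f(x,y,z)=w and x=y had to be variables, the claim would fail (e.g. for f, x1-x2+x3-x4+x5=x6 and ≠). *)

theory Defs
  imports Complex_Main
begin

definition f :: "rat \<Rightarrow> rat \<Rightarrow> rat \<Rightarrow> rat" where
  "f a b c = a - b + c"


section \<open>First-order logic over the structure \<open>(\<rat>; f)\<close>\<close>

datatype trm = Var nat | F trm trm trm

primrec trm_vars :: "trm \<Rightarrow> nat set" where
  "trm_vars (Var x) = {x}"
| "trm_vars (F s t u) = trm_vars s \<union> trm_vars t \<union> trm_vars u"

primrec trm_val :: "(nat \<Rightarrow> rat) \<Rightarrow> trm \<Rightarrow> rat" where
  "trm_val e (Var x) = e x"
| "trm_val e (F s t u) = f (trm_val e s) (trm_val e t) (trm_val e u)"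

datatype form =
    Eq trm trm
  | Neg form
  | Conj form form
  | Exists nat form

primrec free_vars :: "form \<Rightarrow> nat set" where
  "free_vars (Eq s t) = trm_vars s \<union> trm_vars t"
| "free_vars (Neg \<phi>) = free_vars \<phi>"
| "free_vars (Conj \<phi> \<psi>) = free_vars \<phi> \<union> free_vars \<psi>"
| "free_vars (Exists x \<phi>) = free_vars \<phi> - {x}"

primrec sat :: "(nat \<Rightarrow> rat) \<Rightarrow> form \<Rightarrow> bool" where
  "sat e (Eq s t) \<longleftrightarrow> trm_val e s = trm_val e t"
| "sat e (Neg \<phi>) \<longleftrightarrow> \<not> sat e \<phi>"
| "sat e (Conj \<phi> \<psi>) \<longleftrightarrow> sat e \<phi> \<and> sat e \<psi>"
| "sat e (Exists x \<phi>) \<longleftrightarrow> (\<exists>a. sat (e(x := a)) \<phi>)"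

text \<open>
  A \<open>k\<close>-ary relation is a set of lists of length \<open>k\<close>. The free variables of a defining
  formula are among \<open>0, \<dots>, k - 1\<close>, and variable \<open>i\<close> stands for the \<open>i\<close>-th entry of the
  tuple. Definability is without parameters.
\<close>

definition fo_definable :: "nat \<Rightarrow> rat list set \<Rightarrow> bool" where
  "fo_definable k R \<longleftrightarrow>
     (\<exists>\<phi>. free_vars \<phi> \<subseteq> {..<k} \<and> R = {map e [0..<k] | e. sat e \<phi>})"


section \<open>Quantifier-free Horn definitions\<close>

text \<open>
  As usual for a signature with a function symbol, the arguments of an atom are terms, so
  that atoms are arbitrary equations between terms; an atom \<open>f(x,y,z) = w\<close> is
  \<open>EqL (F x y z) w\<close>. Restricting \<open>x\<close>, \<open>y\<close>, \<open>z\<close>, \<open>w\<close> to variables would be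
  a strictly smaller class: the relation \<open>x1 - x2 + x3 - x4 + x5 = x6\<close>, i.e.
  \<open>f(f(x1,x2,x3),x4,x5) = x6\<close>, would have no quantifier-free definition at all.
\<close>

datatype literal = EqL trm trm | NeqL trm trm

type_synonym clause = "literal list"
type_synonym cnf = "clause list"

primrec lit_vars :: "literal \<Rightarrow> nat set" where
  "lit_vars (EqL s t) = trm_vars s \<union> trm_vars t"
| "lit_vars (NeqL s t) = trm_vars s \<union> trm_vars t"

primrec lit_sat :: "(nat \<Rightarrow> rat) \<Rightarrow> literal \<Rightarrow> bool" where
  "lit_sat e (EqL s t) \<longleftrightarrow> trm_val e s = trm_val e t"
| "lit_sat e (NeqL s t) \<longleftrightarrow> trm_val e s \<noteq> trm_val e t"

primrec positive :: "literal \<Rightarrow> bool" where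
  "positive (EqL s t) \<longleftrightarrow> True"
| "positive (NeqL s t) \<longleftrightarrow> False"

definition cnf_vars :: "cnf \<Rightarrow> nat set" where
  "cnf_vars \<Phi> = (\<Union>C\<in>set \<Phi>. \<Union>l\<in>set C. lit_vars l)"

definition cnf_sat :: "(nat \<Rightarrow> rat) \<Rightarrow> cnf \<Rightarrow> bool" where
  "cnf_sat e \<Phi> \<longleftrightarrow> (\<forall>C\<in>set \<Phi>. \<exists>l\<in>set C. lit_sat e l)"

definition horn :: "cnf \<Rightarrow> bool" where
  "horn \<Phi> \<longleftrightarrow> (\<forall>C\<in>set \<Phi>. length (filter positive C) \<le> 1)"

definition horn_definable :: "nat \<Rightarrow> rat list set \<Rightarrow> bool" where
  "horn_definable k R \<longleftrightarrow>
     (\<exists>\<Phi>. horn \<Phi> \<and> cnf_vars \<Phi> \<subseteq> {..<k} \<and> R = {map e [0..<k] | e. cnf_sat e \<Phi>})"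


section \<open>Relational structures and primitive positive definitions\<close>

text \<open>
  The type \<open>'s\<close> is the (arbitrary, possibly infinite) set of relation symbols, and the
  domain is all of \<open>rat\<close>. Carrying the arity with the symbol gives the empty relation
  a definite arity.
\<close>

record 's rel_structure =
  arity :: "'s \<Rightarrow> nat"
  interp :: "'s \<Rightarrow> rat list set"

text \<open>That \<open>interp \<Gamma> R\<close> consists of tuples of length \<open>arity \<Gamma> R\<close> follows from definability.\<close>

definition fo_expansion :: "'s rel_structure \<Rightarrow> bool" where
  "fo_expansion \<Gamma> \<longleftrightarrow>
     (\<exists>R. arity \<Gamma> R = 4 \<and> interp \<Gamma> R = {[a, b, c, d] | a b c d. f a b c = d}) \<and>
     (\<forall>R. fo_definable (arity \<Gamma> R) (interp \<Gamma> R))"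

datatype 's pp_atom = PEq nat nat | PRel 's "nat list"

text \<open>\<open>PP xs \<psi>s\<close> is the formula that existentially quantifies the variables \<open>xs\<close> over the
  conjunction of \<open>\<psi>s\<close>.\<close>

datatype 's pp_form = PP "nat list" "'s pp_atom list"

primrec pp_atom_vars :: "'s pp_atom \<Rightarrow> nat set" where
  "pp_atom_vars (PEq x y) = {x, y}"
| "pp_atom_vars (PRel R ys) = set ys"

primrec pp_atom_wf :: "'s rel_structure \<Rightarrow> 's pp_atom \<Rightarrow> bool" where
  "pp_atom_wf \<Gamma> (PEq x y) \<longleftrightarrow> True"
| "pp_atom_wf \<Gamma> (PRel R ys) \<longleftrightarrow> length ys = arity \<Gamma> R"

primrec pp_atom_sat :: "'s rel_structure \<Rightarrow> (nat \<Rightarrow> rat) \<Rightarrow> 's pp_atom \<Rightarrow> bool" where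
  "pp_atom_sat \<Gamma> e (PEq x y) \<longleftrightarrow> e x = e y"
| "pp_atom_sat \<Gamma> e (PRel R ys) \<longleftrightarrow> map e ys \<in> interp \<Gamma> R"

primrec pp_free_vars :: "'s pp_form \<Rightarrow> nat set" where
  "pp_free_vars (PP xs \<psi>s) = (\<Union>\<psi>\<in>set \<psi>s. pp_atom_vars \<psi>) - set xs"

primrec pp_wf :: "'s rel_structure \<Rightarrow> 's pp_form \<Rightarrow> bool" where
  "pp_wf \<Gamma> (PP xs \<psi>s) \<longleftrightarrow> (\<forall>\<psi>\<in>set \<psi>s. pp_atom_wf \<Gamma> \<psi>)"

primrec pp_sat :: "'s rel_structure \<Rightarrow> (nat \<Rightarrow> rat) \<Rightarrow> 's pp_form \<Rightarrow> bool" where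
  "pp_sat \<Gamma> e (PP xs \<psi>s) \<longleftrightarrow>
     (\<exists>e'. (\<forall>i. i \<notin> set xs \<longrightarrow> e' i = e i) \<and> (\<forall>\<psi>\<in>set \<psi>s. pp_atom_sat \<Gamma> e' \<psi>))"

definition pp_definable :: "'s rel_structure \<Rightarrow> nat \<Rightarrow> rat list set \<Rightarrow> bool" where
  "pp_definable \<Gamma> k R \<longleftrightarrow>
     (\<exists>\<phi>. pp_wf \<Gamma> \<phi> \<and> pp_free_vars \<phi> \<subseteq> {..<k} \<and> R = {map e [0..<k] | e. pp_sat \<Gamma> e \<phi>})"

end

theory Submission
  imports Defs
begin

text \<open>
  Whether a tuple belongs to a first-order definable relation depends only on which of finitely many
  equations it satisfies. Consequently such a relation is invariant under nonconstant affine maps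
  \<open>x \<mapsto> c + d * x\<close>.

  If a nonempty relation contains no constant tuple and \<open>a\<close> is one of its elements, then
  \<open>x + a\<^sub>i * (y - x)\<close> defines \<open>x \<noteq> y\<close>. If a relation \<open>R\<close> is such that for all \<open>a, b \<in> R\<close> infinitely
  many \<open>a + m * b\<close> are in \<open>R\<close>, then it is Horn definable. Otherwise it meets the plane spanned by
  suitable \<open>a, b \<in> R\<close> in finitely many lines including both axes, which yields a primitive positive
  definition of \<open>x = y \<or> u = v\<close>. With \<open>\<noteq>\<close> and this disjunction every clause is primitive
  positive definable.
\<close>

section \<open>Terms as affine combinations\<close>

lemma trm_val_cong: "(\<And>i. i \<in> trm_vars t \<Longrightarrow> e i = e' i) \<Longrightarrow> trm_val e t = trm_val e' t"
  by (induction t) auto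

lemma trm_val_const: "trm_val (\<lambda>_. c) t = c"
  by (induction t) (auto simp: f_def)

lemma trm_val_linear:
  "trm_val (\<lambda>i. u * a i + v * b i) t = u * trm_val a t + v * trm_val b t"
  by (induction t) (auto simp: f_def algebra_simps)

text \<open>The coefficients of a term sum to 1, so only multiples of a difference can be added: the
  value is \<open>b + n * (s - u)\<close>, one application of \<open>F\<close> per unit, with
  \<open>s\<close> and \<open>u\<close> exchanged for negative \<open>n\<close>.\<close>

definition add_multiple :: "trm \<Rightarrow> int \<Rightarrow> trm \<Rightarrow> trm \<Rightarrow> trm" where
  "add_multiple b n s u =
     (if n \<ge> 0 then ((\<lambda>t. F t u s) ^^ nat n) b else ((\<lambda>t. F t s u) ^^ nat (- n)) b)"

lemma trm_val_funpow:
  "trm_val e (((\<lambda>t. F t u s) ^^ n) b) = trm_val e b + of_nat n * (trm_val e s - trm_val e u)"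
  by (induction n) (auto simp: f_def algebra_simps)

lemma trm_vars_funpow:
  "trm_vars (((\<lambda>t. F t u s) ^^ n) b) \<subseteq> trm_vars b \<union> trm_vars s \<union> trm_vars u"
  by (induction n) auto

lemma trm_val_add_multiple [simp]:
  "trm_val e (add_multiple b n s u) = trm_val e b + of_int n * (trm_val e s - trm_val e u)"
  by (auto simp: add_multiple_def trm_val_funpow algebra_simps)

lemma trm_vars_add_multiple:
  "trm_vars (add_multiple b n s u) \<subseteq> trm_vars b \<union> trm_vars s \<union> trm_vars u"
  using trm_vars_funpow[of "nat n" u s b] trm_vars_funpow[of "nat (- n)" s u b]
  by (auto simp: add_multiple_def)

text \<open>Replacing \<open>x\<close> by \<open>v\<close> keeps the coefficient sum at 1, which
  deleting \<open>x\<close> would not; \<open>n\<close> is the coefficient of \<open>x\<close> in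
  \<open>t\<close>.\<close>

lemma trm_eliminate_var:
  assumes "trm_vars t \<subseteq> insert x V" "v \<in> V"
  shows "\<exists>n t'. trm_vars t' \<subseteq> V \<and>
           (\<forall>e. trm_val e t = of_int n * (e x - e v) + trm_val e t')"
  using assms(1)
proof (induction t)
  case (Var y)
  show ?case
  proof (cases "y = x")
    case True
    then show ?thesis
      using assms(2) by (intro exI[of _ 1] exI[of _ "Var v"]) auto
  next
    case False
    then show ?thesis
      using Var by (intro exI[of _ 0] exI[of _ "Var y"]) auto
  qed
next
  case (F p q r)
  from F obtain n1 p' where p: "trm_vars p' \<subseteq> V"
      "\<And>e. trm_val e p = of_int n1 * (e x - e v) + trm_val e p'" by auto
  from F obtain n2 q' where q: "trm_vars q' \<subseteq> V"
      "\<And>e. trm_val e q = of_int n2 * (e x - e v) + trm_val e q'" by auto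
  from F obtain n3 r' where r: "trm_vars r' \<subseteq> V"
      "\<And>e. trm_val e r = of_int n3 * (e x - e v) + trm_val e r'" by auto
  show ?case
    using p(1) q(1) r(1)
    by (intro exI[of _ "n1 - n2 + n3"] exI[of _ "F p' q' r'"])
      (simp add: f_def p(2) q(2) r(2) ring_distribs)
qed

lemma trm_val_single_var: "trm_vars t \<subseteq> {x} \<Longrightarrow> trm_val e t = e x"
  by (induction t) (auto simp: f_def)


section \<open>Predicates determined by finitely many equations\<close>

type_synonym equation = "trm \<times> trm"

definition eq_vars :: "equation \<Rightarrow> nat set" where
  "eq_vars g = trm_vars (fst g) \<union> trm_vars (snd g)"

definition defect :: "(nat \<Rightarrow> rat) \<Rightarrow> equation \<Rightarrow> rat" where
  "defect e g = trm_val e (fst g) - trm_val e (snd g)"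

text \<open>For finite \<open>G\<close> this is the semantic counterpart of being a Boolean
  combination of the equations in \<open>G\<close>.\<close>

definition determined_by :: "equation set \<Rightarrow> ((nat \<Rightarrow> rat) \<Rightarrow> bool) \<Rightarrow> bool" where
  "determined_by G P \<longleftrightarrow>
     (\<forall>e e'. (\<forall>g\<in>G. defect e g = 0 \<longleftrightarrow> defect e' g = 0) \<longrightarrow> P e \<longleftrightarrow> P e')"

lemma determined_byD:
  "determined_by G P \<Longrightarrow> (\<And>g. g \<in> G \<Longrightarrow> defect e g = 0 \<longleftrightarrow> defect e' g = 0) \<Longrightarrow> P e \<longleftrightarrow> P e'"
  unfolding determined_by_def by metis

lemma defect_cong: "(\<And>i. i \<in> eq_vars g \<Longrightarrow> e i = e' i) \<Longrightarrow> defect e g = defect e' g"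
  unfolding defect_def eq_vars_def using trm_val_cong[of _ e e'] by (metis UnCI)

lemma defect_linear:
  "defect (\<lambda>i. u * a i + v * b i) g = u * defect a g + v * defect b g"
  by (simp add: defect_def trm_val_linear algebra_simps)

lemma defect_const: "defect (\<lambda>_. c) g = 0"
  by (simp add: defect_def trm_val_const)

lemma defect_translate: "defect (\<lambda>i. c + a i) g = defect a g"
  using defect_linear[of 1 "\<lambda>_. c" 1 a g] by (simp add: defect_const)

text \<open>A defect is a linear form with coefficient sum 0: translation leaves it unchanged, and
  scaling by \<open>d \<noteq> 0\<close> preserves whether it vanishes.\<close>

lemma determined_by_affine:
  assumes "determined_by G P" "d \<noteq> 0"
  shows "P (\<lambda>i. c + d * a i) \<longleftrightarrow> P a"
proof (rule determined_byD[OF assms(1)])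
  fix g
  show "defect (\<lambda>i. c + d * a i) g = 0 \<longleftrightarrow> defect a g = 0"
    using defect_translate[of c "\<lambda>i. d * a i"] defect_linear[of d a 0 a g] assms(2) by simp
qed

lemma determined_by_const:
  "determined_by G P \<Longrightarrow> P (\<lambda>_. c) \<longleftrightarrow> P (\<lambda>_. d)"
  by (erule determined_byD) (simp add: defect_const)

text \<open>The linear combination m g - n h of two equations, written with terms again;
  \<open>fst g\<close> on both sides supplies the coefficient sum 1. Suitable \<open>m\<close> and
  \<open>n\<close> cancel a common variable.\<close>

definition resultant :: "int \<Rightarrow> equation \<Rightarrow> int \<Rightarrow> equation \<Rightarrow> equation" where
  "resultant m g n h =
     (add_multiple (add_multiple (fst g) m (fst g) (snd g)) n (snd h) (fst h), fst g)"

lemma defect_resultant: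
  "defect e (resultant m g n h) = of_int m * defect e g - of_int n * defect e h"
  by (simp add: resultant_def defect_def algebra_simps)

lemma eq_vars_resultant: "eq_vars (resultant m g n h) \<subseteq> eq_vars g \<union> eq_vars h"
  unfolding resultant_def eq_vars_def
  using trm_vars_add_multiple[of "add_multiple (fst g) m (fst g) (snd g)" n "snd h" "fst h"]
    trm_vars_add_multiple[of "fst g" m "fst g" "snd g"] by auto

lemma eq_eliminate_var:
  assumes "eq_vars g \<subseteq> insert x V" "v \<in> V"
  shows "\<exists>n h. eq_vars h \<subseteq> V \<and> (\<forall>e. defect e g = of_int n * (e x - e v) + defect e h)"
proof -
  obtain n s where s: "trm_vars s \<subseteq> V"
      "\<And>e. trm_val e (fst g) = of_int n * (e x - e v) + trm_val e s"
    using trm_eliminate_var[of "fst g" x V v] assms by (auto simp: eq_vars_def)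
  obtain m t where t: "trm_vars t \<subseteq> V"
      "\<And>e. trm_val e (snd g) = of_int m * (e x - e v) + trm_val e t"
    using trm_eliminate_var[of "snd g" x V v] assms by (auto simp: eq_vars_def)
  show ?thesis
    using s(1) t(1)
    by (intro exI[of _ "n - m"] exI[of _ "(s, t)"])
      (simp add: eq_vars_def defect_def s(2) t(2) ring_distribs)
qed

text \<open>Quantifier elimination by a one-step back-and-forth: the equations in \<open>G'\<close> decide which
  sets of equations of \<open>G\<close> can be realised by a suitable value of \<open>x\<close>.\<close>

lemma determined_by_exists:
  assumes G: "finite G" "\<And>g. g \<in> G \<Longrightarrow> eq_vars g \<subseteq> insert x V" and x: "x \<notin> V"
    and P: "determined_by G P"
  shows "\<exists>G'. finite G' \<and> (\<forall>g\<in>G'. eq_vars g \<subseteq> V) \<and> determined_by G' (\<lambda>e. \<exists>a. P (e(x := a)))"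
proof (cases "V = {}")
  case True
  \<comment> \<open>With \<open>x\<close> as the only variable, idempotence of \<open>f\<close>
    makes every equation of \<open>G\<close> true.\<close>
  have "defect e g = 0" if "g \<in> G" for e g
    using G(2)[OF that] True
    by (simp add: eq_vars_def defect_def trm_val_single_var[of _ x])
  then have "P e \<longleftrightarrow> P e'" for e e'
    by (intro determined_byD[OF P]) simp
  then show ?thesis
    by (intro exI[of _ "{}"]) (auto simp: determined_by_def)
next
  case False
  then obtain v where v: "v \<in> V" by auto
  have "\<forall>g\<in>G. \<exists>n h. eq_vars h \<subseteq> V \<and> (\<forall>e. defect e g = of_int n * (e x - e v) + defect e h)"
    using eq_eliminate_var[OF G(2) v] by blast
  then obtain N H where H: "\<And>g. g \<in> G \<Longrightarrow> eq_vars (H g) \<subseteq> V"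
    and NH: "\<And>g e. g \<in> G \<Longrightarrow> defect e g = of_int (N g) * (e x - e v) + defect e (H g)"
    by metis
  \<comment> \<open>\<open>H g\<close> is what remains of \<open>g\<close> without \<open>x\<close>.
    For \<open>N g \<noteq> 0\<close> the resultant of \<open>g\<close> and \<open>h\<close> tells
    whether \<open>h\<close> holds where \<open>x\<close> takes the root of
    \<open>g\<close>.\<close>
  define G' where "G' = H ` G \<union> (\<lambda>(g, h). resultant (N g) (H h) (N h) (H g)) ` (G \<times> G)"
  have fin: "finite G'" unfolding G'_def using G(1) by auto
  have vars: "eq_vars r \<subseteq> V" if "r \<in> G'" for r
  proof -
    from that have "(\<exists>g\<in>G. r = H g) \<or>
        (\<exists>g\<in>G. \<exists>h\<in>G. r = resultant (N g) (H h) (N h) (H g))"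
      unfolding G'_def by auto
    then show ?thesis
    proof (elim disjE bexE)
      fix g h assume "g \<in> G" "h \<in> G" "r = resultant (N g) (H h) (N h) (H g)"
      then show ?thesis
        using H eq_vars_resultant[of "N g" "H h" "N h" "H g"] by blast
    qed (use H in auto)
  qed
  have upd: "defect (e(x := a)) g = of_int (N g) * (a - e v) + defect e (H g)"
    if "g \<in> G" for e g a
  proof -
    have "defect (e(x := a)) (H g) = defect e (H g)"
      using H[OF that] x by (intro defect_cong) auto
    moreover have "x \<noteq> v" using v x by auto
    ultimately show ?thesis using NH[OF that, of "e(x := a)"] by simp
  qed
  have step: "\<exists>a'. P (e'(x := a'))"
    if same: "\<And>r. r \<in> G' \<Longrightarrow> defect e r = 0 \<longleftrightarrow> defect e' r = 0" and Pa: "P (e(x := a))" for e e' a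
  proof -
    have same_H: "defect e (H g) = 0 \<longleftrightarrow> defect e' (H g) = 0" if "g \<in> G" for g
      using same that unfolding G'_def by auto
    have "\<exists>a'. \<forall>g\<in>G. defect (e(x := a)) g = 0 \<longleftrightarrow> defect (e'(x := a')) g = 0"
    proof (cases "\<exists>g\<in>G. N g \<noteq> 0 \<and> defect (e(x := a)) g = 0")
      case True
      then obtain g where g: "g \<in> G" "N g \<noteq> 0" "defect (e(x := a)) g = 0" by auto
      define a' where "a' = e' v - defect e' (H g) / of_int (N g)"
      have g': "defect (e'(x := a')) g = 0"
        using g by (simp add: upd a'_def)
      have zero: "defect (d(x := c)) h = 0 \<longleftrightarrow> defect d (resultant (N g) (H h) (N h) (H g)) = 0"
        if "h \<in> G" "defect (d(x := c)) g = 0" for d c h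
      proof -
        have "of_int (N g) * defect (d(x := c)) h
            = of_int (N g) * defect (d(x := c)) h - of_int (N h) * defect (d(x := c)) g"
          using that by simp
        also have "\<dots> = defect d (resultant (N g) (H h) (N h) (H g))"
          using that(1) g(1) by (simp add: upd defect_resultant algebra_simps)
        finally show ?thesis using g(2) by (metis mult_eq_0_iff of_int_eq_0_iff)
      qed
      have "resultant (N g) (H h) (N h) (H g) \<in> G'" if "h \<in> G" for h
        unfolding G'_def using that g(1) by auto
      then show ?thesis using zero g(3) g' same by blast
    next
      case False
      \<comment> \<open>No equation that really involves \<open>x\<close> holds at
        \<open>e(x := a)\<close>, so \<open>a'\<close> only has to avoid the finitely many roots
        over \<open>e'\<close>. Where \<open>N g = 0\<close>, division by zero merely excludes one
        extra point.\<close>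
      have "finite ((\<lambda>g. e' v - defect e' (H g) / of_int (N g)) ` G)" using G(1) by simp
      then obtain a' where a': "a' \<notin> (\<lambda>g. e' v - defect e' (H g) / of_int (N g)) ` G"
        using ex_new_if_finite infinite_UNIV_char_0 by blast
      have "defect (e(x := a)) g = 0 \<longleftrightarrow> defect (e'(x := a')) g = 0" if g: "g \<in> G" for g
      proof (cases "N g = 0")
        case True
        then show ?thesis using same_H g by (simp add: upd)
      next
        case N: False
        have "a' \<noteq> e' v - defect e' (H g) / of_int (N g)" using a' g by auto
        then have "defect (e'(x := a')) g \<noteq> 0"
          using N by (auto simp: upd[OF g] field_simps)
        then show ?thesis using False N g by auto
      qed
      then show ?thesis by blast
    qed
    then show ?thesis using determined_byD[OF P] Pa by blast
  qed
  have "determined_by G' (\<lambda>e. \<exists>a. P (e(x := a)))"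
    unfolding determined_by_def using step by metis
  then show ?thesis using fin vars by blast
qed

lemma sat_determined:
  "\<exists>G. finite G \<and> (\<forall>g\<in>G. eq_vars g \<subseteq> free_vars \<phi>) \<and> determined_by G (\<lambda>e. sat e \<phi>)"
proof (induction \<phi>)
  case (Eq s t)
  show ?case
    by (intro exI[of _ "{(s, t)}"]) (auto simp: determined_by_def defect_def eq_vars_def)
next
  case (Neg \<phi>)
  then show ?case by (auto simp: determined_by_def)
next
  case (Conj \<phi> \<psi>)
  then obtain G H where "finite G" "\<forall>g\<in>G. eq_vars g \<subseteq> free_vars \<phi>" "determined_by G (\<lambda>e. sat e \<phi>)"
    "finite H" "\<forall>g\<in>H. eq_vars g \<subseteq> free_vars \<psi>" "determined_by H (\<lambda>e. sat e \<psi>)" by blast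
  moreover from this have "determined_by (G \<union> H) (\<lambda>e. sat e (Conj \<phi> \<psi>))"
    unfolding determined_by_def by (metis UnCI sat.simps(3))
  ultimately show ?case by (intro exI[of _ "G \<union> H"]) auto
next
  case (Exists x \<phi>)
  then obtain G where G: "finite G" "\<forall>g\<in>G. eq_vars g \<subseteq> free_vars \<phi>" "determined_by G (\<lambda>e. sat e \<phi>)"
    by blast
  have "eq_vars g \<subseteq> insert x (free_vars \<phi> - {x})" if "g \<in> G" for g
    using G(2) that by auto
  from determined_by_exists[OF G(1) this _ G(3)] show ?case by simp
qed

text \<open>Passes from tuples to assignments, where linear combinations are taken pointwise. The
  third conclusion records that \<open>R\<close> has only tuples of length \<open>k\<close>.\<close>

lemma fo_definable_determined:
  assumes "fo_definable k R"
  obtains G where "\<And>g. g \<in> set G \<Longrightarrow> eq_vars g \<subseteq> {..<k}"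
    and "determined_by (set G) (\<lambda>e. map e [0..<k] \<in> R)"
    and "R = {map e [0..<k] | e. map e [0..<k] \<in> R}"
proof -
  obtain \<phi> where \<phi>: "free_vars \<phi> \<subseteq> {..<k}" "R = {map e [0..<k] | e. sat e \<phi>}"
    using assms unfolding fo_definable_def by blast
  obtain G0 where G0: "finite G0" "\<forall>g\<in>G0. eq_vars g \<subseteq> free_vars \<phi>"
      "determined_by G0 (\<lambda>e. sat e \<phi>)"
    using sat_determined by blast
  obtain G where "set G = G0" using finite_list[OF G0(1)] by blast
  with G0 have G: "\<forall>g\<in>set G. eq_vars g \<subseteq> free_vars \<phi>" "determined_by (set G) (\<lambda>e. sat e \<phi>)"
    by auto
  have "sat e \<phi> \<longleftrightarrow> sat e' \<phi>" if "map e [0..<k] = map e' [0..<k]" for e e'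
  proof (rule determined_byD[OF G(2)])
    fix g assume "g \<in> set G"
    then have "defect e g = defect e' g"
      using G(1) \<phi>(1) that by (intro defect_cong) (auto simp: map_eq_conv subset_iff)
    then show "defect e g = 0 \<longleftrightarrow> defect e' g = 0" by simp
  qed
  then have mem: "map e [0..<k] \<in> R \<longleftrightarrow> sat e \<phi>" for e
    using \<phi>(2) by blast
  show ?thesis
    using that[of G] G \<phi> unfolding mem by blast
qed


section \<open>Horn definability\<close>

definition clause_of :: "equation list \<Rightarrow> equation list \<Rightarrow> clause" where
  "clause_of A B = map (\<lambda>g. NeqL (fst g) (snd g)) A @ map (\<lambda>g. EqL (fst g) (snd g)) B"

lemma filter_in_subseqs: "filter p xs \<in> set (subseqs xs)"
  by (induction xs) (auto simp: Let_def)

lemma clause_of_sat: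
  "(\<exists>l\<in>set (clause_of A B). lit_sat e l) \<longleftrightarrow>
     (\<exists>g\<in>set A. defect e g \<noteq> 0) \<or> (\<exists>g\<in>set B. defect e g = 0)"
  by (simp add: clause_of_def defect_def bex_Un)

lemma clause_of_vars: "(\<Union>l\<in>set (clause_of A B). lit_vars l) = (\<Union>g\<in>set A \<union> set B. eq_vars g)"
  by (auto simp: clause_of_def eq_vars_def)

lemma clause_of_positive: "length (filter positive (clause_of A B)) = length B"
  by (auto simp: clause_of_def filter_map comp_def)

text \<open>The candidate clauses have the form \<open>A \<Longrightarrow> h\<close> or \<open>A \<Longrightarrow> False\<close> with equations from \<open>G\<close> only. If
  \<open>e\<close> satisfies all those valid in \<open>P\<close>, there are points of \<open>P\<close> that satisfy the equations true
  at \<open>e\<close> and violate any single other equation of \<open>G\<close>. A generic linear combination of them then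
  satisfies exactly the same equations of \<open>G\<close> as \<open>e\<close>.\<close>

lemma horn_cnf_if_closed:
  assumes vars: "\<And>g. g \<in> set G \<Longrightarrow> eq_vars g \<subseteq> V"
    and det: "determined_by (set G) P"
    and closed: "\<And>a b. P a \<Longrightarrow> P b \<Longrightarrow> infinite {\<mu>. P (\<lambda>i. a i + \<mu> * b i)}"
  shows "\<exists>\<Phi>. horn \<Phi> \<and> cnf_vars \<Phi> \<subseteq> V \<and> (\<forall>e. cnf_sat e \<Phi> \<longleftrightarrow> P e)"
proof -
  define valid where "valid A B \<longleftrightarrow>
    (\<forall>e. P e \<longrightarrow> (\<exists>g\<in>set A. defect e g \<noteq> 0) \<or> (\<exists>g\<in>set B. defect e g = 0))" for A B
  define \<Phi> where "\<Phi> = map (\<lambda>(A, B). clause_of A B)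
    (filter (\<lambda>(A, B). valid A B) (List.product (subseqs G) ([] # map (\<lambda>h. [h]) G)))"
  have in_\<Phi>: "C \<in> set \<Phi> \<longleftrightarrow> (\<exists>A B. C = clause_of A B \<and> valid A B \<and> A \<in> set (subseqs G) \<and>
      (B = [] \<or> (\<exists>h\<in>set G. B = [h])))" for C
    unfolding \<Phi>_def by (auto simp: image_iff)
  have sub: "set A \<subseteq> set G" if "A \<in> set (subseqs G)" for A
    using that subseqs_powset by (metis Pow_iff image_eqI)
  have "length (filter positive C) \<le> 1" if "C \<in> set \<Phi>" for C
    using that unfolding in_\<Phi> by (auto simp: clause_of_positive)
  then have "horn \<Phi>" unfolding horn_def by blast
  moreover have "cnf_vars \<Phi> \<subseteq> V"
  proof -
    have "(\<Union>l\<in>set C. lit_vars l) \<subseteq> V" if "C \<in> set \<Phi>" for C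
    proof -
      from that obtain A B where C: "C = clause_of A B" "A \<in> set (subseqs G)"
          "B = [] \<or> (\<exists>h\<in>set G. B = [h])"
        unfolding in_\<Phi> by blast
      then have "set A \<union> set B \<subseteq> set G" using sub by auto
      then show ?thesis using vars unfolding C(1) clause_of_vars by blast
    qed
    then show ?thesis unfolding cnf_vars_def by blast
  qed
  moreover have "cnf_sat e \<Phi> \<longleftrightarrow> P e" for e
  proof
    assume "P e"
    have "\<exists>l\<in>set C. lit_sat e l" if "C \<in> set \<Phi>" for C
    proof -
      from that obtain A B where "C = clause_of A B" "valid A B" unfolding in_\<Phi> by blast
      with \<open>P e\<close> show ?thesis unfolding valid_def by (simp add: clause_of_sat)
    qed
    then show "cnf_sat e \<Phi>" unfolding cnf_sat_def by blast
  next
    assume e: "cnf_sat e \<Phi>"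
    \<comment> \<open>These are the equations true at \<open>e\<close>. A clause with premises
      \<open>A\<close> and a head false at \<open>e\<close>, or no head, is violated by
      \<open>e\<close> and hence is not valid.\<close>
    define A where "A = filter (\<lambda>g. defect e g = 0) G"
    have A: "A \<in> set (subseqs G)" unfolding A_def by (rule filter_in_subseqs)
    have not_valid: "\<not> valid A B"
      if "B = [] \<or> (\<exists>h\<in>set G. B = [h])" "\<forall>g\<in>set B. defect e g \<noteq> 0" for B
    proof
      assume "valid A B"
      then have "clause_of A B \<in> set \<Phi>" using in_\<Phi> A that(1) by blast
      then have "\<exists>l\<in>set (clause_of A B). lit_sat e l"
        using e unfolding cnf_sat_def by blast
      then show False using that(2) unfolding clause_of_sat A_def by auto
    qed
    have gen: "\<exists>y. P y \<and> (\<forall>g\<in>set A. defect y g = 0) \<and> (\<forall>h\<in>set H. defect y h \<noteq> 0)"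
      if "\<forall>h\<in>set H. h \<in> set G \<and> defect e h \<noteq> 0" for H
      using that
    proof (induction H)
      case Nil
      then show ?case using not_valid[of "[]"] unfolding valid_def by auto
    next
      case (Cons h H)
      then obtain y where y: "P y" "\<forall>g\<in>set A. defect y g = 0" "\<forall>h\<in>set H. defect y h \<noteq> 0"
        by auto
      have "\<not> valid A [h]" using Cons.prems by (intro not_valid) auto
      then obtain b where b: "P b" "\<forall>g\<in>set A. defect b g = 0" "defect b h \<noteq> 0"
        unfolding valid_def by auto
      \<comment> \<open>For each \<open>h'\<close> at most one \<mu> is bad, as its defects at
        \<open>y\<close> and \<open>b\<close> are not both 0: \<open>b\<close> violates
        \<open>h\<close>, and \<open>y\<close> violates every equation in \<open>H\<close>.\<close>
      have "\<mu> \<in> (\<lambda>h'. - defect y h' / defect b h') ` set (h # H)"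
        if "h' \<in> set (h # H)" "defect y h' + \<mu> * defect b h' = 0" for h' \<mu>
      proof (cases "defect b h' = 0")
        case True
        then show ?thesis using that y(3) b(3) by auto
      next
        case False
        then have "\<mu> = - defect y h' / defect b h'" using that(2) by (simp add: field_simps)
        then show ?thesis using that(1) by blast
      qed
      moreover have "infinite ({\<mu>. P (\<lambda>i. y i + \<mu> * b i)}
          - (\<lambda>h'. - defect y h' / defect b h') ` set (h # H))"
        using closed[OF y(1) b(1)] by (intro Diff_infinite_finite) auto
      then obtain \<mu> where "\<mu> \<in> {\<mu>. P (\<lambda>i. y i + \<mu> * b i)}
          - (\<lambda>h'. - defect y h' / defect b h') ` set (h # H)"
        using infinite_imp_nonempty by blast
      ultimately have \<mu>: "P (\<lambda>i. y i + \<mu> * b i)"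
        "\<forall>h'\<in>set (h # H). defect y h' + \<mu> * defect b h' \<noteq> 0"
        by blast+
      have "defect (\<lambda>i. y i + \<mu> * b i) g = defect y g + \<mu> * defect b g" for g
        using defect_linear[of 1 y \<mu> b g] by simp
      with \<mu> y(2) b(2) show ?case
        by (intro exI[of _ "\<lambda>i. y i + \<mu> * b i"]) simp
    qed
    obtain y where y: "P y" "\<forall>g\<in>set A. defect y g = 0"
        "\<forall>h\<in>set (filter (\<lambda>g. defect e g \<noteq> 0) G). defect y h \<noteq> 0"
      using gen[of "filter (\<lambda>g. defect e g \<noteq> 0) G"] by auto
    have "P e \<longleftrightarrow> P y"
      using y(2,3) by (intro determined_byD[OF det]) (auto simp: A_def)
    with y(1) show "P e" by simp
  qed
  ultimately show ?thesis by blast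
qed

text \<open>The clause \<open>cl A\<close> fails exactly where the true equations of
  \<open>G\<close> are those in \<open>A\<close>, so keeping the valid clauses excludes precisely
  the patterns that do not occur in \<open>P\<close>.\<close>

lemma cnf_if_determined:
  assumes det: "determined_by (set G) P"
  shows "\<exists>\<Phi>. \<forall>e. cnf_sat e \<Phi> \<longleftrightarrow> P e"
proof -
  define cl where "cl A = clause_of A (filter (\<lambda>g. g \<notin> set A) G)" for A
  define \<Phi> where "\<Phi> = filter (\<lambda>C. \<forall>e. P e \<longrightarrow> (\<exists>l\<in>set C. lit_sat e l)) (map cl (subseqs G))"
  have "cnf_sat e \<Phi> \<longleftrightarrow> P e" for e
  proof
    show "P e \<Longrightarrow> cnf_sat e \<Phi>" unfolding cnf_sat_def \<Phi>_def by auto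
  next
    assume e: "cnf_sat e \<Phi>"
    define A where "A = filter (\<lambda>g. defect e g = 0) G"
    have "\<not> (\<exists>l\<in>set (cl A). lit_sat e l)"
      unfolding cl_def clause_of_sat by (auto simp: A_def)
    then have "cl A \<notin> set \<Phi>" using e unfolding cnf_sat_def by blast
    moreover have "cl A \<in> set (map cl (subseqs G))"
      unfolding set_map A_def by (intro imageI filter_in_subseqs)
    ultimately obtain y where y: "P y" "\<not> (\<exists>l\<in>set (cl A). lit_sat y l)"
      unfolding \<Phi>_def by auto
    have "P e \<longleftrightarrow> P y"
      using y(2) unfolding cl_def clause_of_sat
      by (intro determined_byD[OF det]) (auto simp: A_def)
    with y(1) show "P e" by simp
  qed
  then show ?thesis by blast
qed


section \<open>Primitive positive predicates\<close>

text \<open>Predicates on whole assignments, without a bound on the free variables, compose easily;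
  arities return in \<open>pp_definable_if_pp_pred\<close>.\<close>

definition pp_pred :: "'s rel_structure \<Rightarrow> ((nat \<Rightarrow> rat) \<Rightarrow> bool) \<Rightarrow> bool" where
  "pp_pred \<Gamma> P \<longleftrightarrow> (\<exists>\<phi>. pp_wf \<Gamma> \<phi> \<and> (\<forall>e. pp_sat \<Gamma> e \<phi> \<longleftrightarrow> P e))"

primrec pp_atom_rename :: "(nat \<Rightarrow> nat) \<Rightarrow> 's pp_atom \<Rightarrow> 's pp_atom" where
  "pp_atom_rename \<tau> (PEq x y) = PEq (\<tau> x) (\<tau> y)"
| "pp_atom_rename \<tau> (PRel R ys) = PRel R (map \<tau> ys)"

lemma pp_atom_rename_sat: "pp_atom_sat \<Gamma> e (pp_atom_rename \<tau> \<psi>) = pp_atom_sat \<Gamma> (e \<circ> \<tau>) \<psi>"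
  by (cases \<psi>) auto

lemma pp_atom_rename_wf: "pp_atom_wf \<Gamma> (pp_atom_rename \<tau> \<psi>) = pp_atom_wf \<Gamma> \<psi>"
  by (cases \<psi>) auto

lemma pp_atom_rename_vars: "pp_atom_vars (pp_atom_rename \<tau> \<psi>) = \<tau> ` pp_atom_vars \<psi>"
  by (cases \<psi>) auto

lemma pp_atom_sat_cong:
  "(\<And>i. i \<in> pp_atom_vars \<psi> \<Longrightarrow> e i = e' i) \<Longrightarrow> pp_atom_sat \<Gamma> e \<psi> = pp_atom_sat \<Gamma> e' \<psi>"
proof (cases \<psi>)
  case (PRel R ys)
  assume "\<And>i. i \<in> pp_atom_vars \<psi> \<Longrightarrow> e i = e' i"
  then have "map e ys = map e' ys" using PRel by auto
  then show ?thesis using PRel by (metis pp_atom_sat.simps(2))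
qed auto

lemma finite_pp_atom_vars [simp]: "finite (pp_atom_vars \<psi>)"
  by (cases \<psi>) auto

text \<open>Capture-avoiding renaming of free variables by \<sigma>, with the bound variables moved
  to \<open>N\<close> or above so that formulas can later be conjoined.\<close>

lemma pp_rename_away:
  assumes "pp_wf \<Gamma> (PP xs \<psi>s)"
  obtains ys \<chi>s where "pp_wf \<Gamma> (PP ys \<chi>s)" "\<forall>y\<in>set ys. N \<le> y"
    "(\<Union>\<chi>\<in>set \<chi>s. pp_atom_vars \<chi>) \<subseteq> \<sigma> ` (\<Union>\<psi>\<in>set \<psi>s. pp_atom_vars \<psi>) \<union> set ys"
    "\<And>e. pp_sat \<Gamma> e (PP ys \<chi>s) \<longleftrightarrow> pp_sat \<Gamma> (e \<circ> \<sigma>) (PP xs \<psi>s)"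
proof -
  define W where "W = \<sigma> ` (\<Union>\<psi>\<in>set \<psi>s. pp_atom_vars \<psi>)"
  have "finite W" unfolding W_def by auto
  then obtain M where M: "\<And>i. i \<in> W \<Longrightarrow> i < M"
    by (meson finite_nat_set_iff_bounded)
  define K where "K = max M N"
  define \<tau> where "\<tau> i = (if i \<in> set xs then K + i else \<sigma> i)" for i
  let ?ys = "map (\<lambda>i. K + i) xs" and ?\<chi>s = "map (pp_atom_rename \<tau>) \<psi>s"
  have "pp_wf \<Gamma> (PP ?ys ?\<chi>s)"
    using assms by (auto simp: pp_atom_rename_wf)
  moreover have "\<forall>y\<in>set ?ys. N \<le> y" by (auto simp: K_def)
  moreover have "(\<Union>\<chi>\<in>set ?\<chi>s. pp_atom_vars \<chi>) \<subseteq> \<sigma> ` (\<Union>\<psi>\<in>set \<psi>s. pp_atom_vars \<psi>) \<union> set ?ys"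
    by (auto simp: pp_atom_rename_vars \<tau>_def)
  moreover have "pp_sat \<Gamma> e (PP ?ys ?\<chi>s) \<longleftrightarrow> pp_sat \<Gamma> (e \<circ> \<sigma>) (PP xs \<psi>s)" for e
  proof
    assume "pp_sat \<Gamma> e (PP ?ys ?\<chi>s)"
    then obtain e' where e': "\<And>i. i \<notin> set ?ys \<Longrightarrow> e' i = e i"
        "\<And>\<psi>. \<psi> \<in> set \<psi>s \<Longrightarrow> pp_atom_sat \<Gamma> (e' \<circ> \<tau>) \<psi>"
      by (auto simp: pp_atom_rename_sat)
    define d where "d i = (if i \<in> set xs then e' (K + i) else e (\<sigma> i))" for i
    have "pp_atom_sat \<Gamma> d \<psi>" if "\<psi> \<in> set \<psi>s" for \<psi>
    proof -
      have "d i = (e' \<circ> \<tau>) i" if "i \<in> pp_atom_vars \<psi>" for i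
      proof (cases "i \<in> set xs")
        case False
        have "\<sigma> i < M" using M that \<open>\<psi> \<in> set \<psi>s\<close> unfolding W_def by auto
        then have "\<sigma> i \<notin> set ?ys" by (auto simp: K_def)
        then show ?thesis using False e'(1) by (simp add: d_def \<tau>_def)
      qed (simp add: d_def \<tau>_def)
      then show ?thesis using e'(2)[OF \<open>\<psi> \<in> set \<psi>s\<close>] pp_atom_sat_cong by metis
    qed
    then show "pp_sat \<Gamma> (e \<circ> \<sigma>) (PP xs \<psi>s)"
      by (auto simp: d_def intro!: exI[of _ d])
  next
    assume "pp_sat \<Gamma> (e \<circ> \<sigma>) (PP xs \<psi>s)"
    then obtain d where d: "\<And>i. i \<notin> set xs \<Longrightarrow> d i = e (\<sigma> i)"
        "\<And>\<psi>. \<psi> \<in> set \<psi>s \<Longrightarrow> pp_atom_sat \<Gamma> d \<psi>" by auto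
    define e' where "e' j = (if j \<in> set ?ys then d (j - K) else e j)" for j
    have "pp_atom_sat \<Gamma> (e' \<circ> \<tau>) \<psi>" if "\<psi> \<in> set \<psi>s" for \<psi>
    proof -
      have "d i = (e' \<circ> \<tau>) i" if "i \<in> pp_atom_vars \<psi>" for i
      proof (cases "i \<in> set xs")
        case False
        have "\<sigma> i < M" using M that \<open>\<psi> \<in> set \<psi>s\<close> unfolding W_def by auto
        then have "\<sigma> i \<notin> set ?ys" by (auto simp: K_def)
        then show ?thesis using False d(1) by (simp add: e'_def \<tau>_def)
      qed (auto simp: e'_def \<tau>_def)
      then show ?thesis using d(2)[OF \<open>\<psi> \<in> set \<psi>s\<close>] pp_atom_sat_cong by metis
    qed
    then show "pp_sat \<Gamma> e (PP ?ys ?\<chi>s)"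
      by (auto simp: e'_def pp_atom_rename_sat intro!: exI[of _ e'])
  qed
  ultimately show ?thesis using that by blast
qed

section \<open>Closure properties of primitive positive predicates\<close>

lemma pp_pred_cong: "pp_pred \<Gamma> P \<Longrightarrow> (\<And>e. P e \<longleftrightarrow> Q e) \<Longrightarrow> pp_pred \<Gamma> Q"
  unfolding pp_pred_def by metis

lemma pp_pred_rename: "pp_pred \<Gamma> P \<Longrightarrow> pp_pred \<Gamma> (\<lambda>e. P (e \<circ> \<sigma>))"
  unfolding pp_pred_def by (metis pp_form.exhaust pp_rename_away)

lemma pp_pred_atom: "pp_atom_wf \<Gamma> \<psi> \<Longrightarrow> pp_pred \<Gamma> (\<lambda>e. pp_atom_sat \<Gamma> e \<psi>)"
  unfolding pp_pred_def by (rule exI[of _ "PP [] [\<psi>]"]) (use pp_atom_sat_cong in \<open>auto, blast\<close>)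

lemma pp_pred_rel:
  "length ys = arity \<Gamma> R \<Longrightarrow> pp_pred \<Gamma> (\<lambda>e. map e ys \<in> interp \<Gamma> R)"
  using pp_pred_atom[of \<Gamma> "PRel R ys"] by simp

lemma pp_pred_True: "pp_pred \<Gamma> (\<lambda>e. True)"
  unfolding pp_pred_def by (rule exI[of _ "PP [] []"]) auto

lemma pp_pred_var_eq: "pp_pred \<Gamma> (\<lambda>e. e x = e y)"
  using pp_pred_atom[of \<Gamma> "PEq x y"] by simp

lemma pp_pred_conj:
  assumes "pp_pred \<Gamma> P" "pp_pred \<Gamma> Q"
  shows "pp_pred \<Gamma> (\<lambda>e. P e \<and> Q e)"
proof -
  from assms(1) obtain xs0 \<psi>s0 where 1: "pp_wf \<Gamma> (PP xs0 \<psi>s0)"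
      "\<And>e. pp_sat \<Gamma> e (PP xs0 \<psi>s0) \<longleftrightarrow> P e"
    unfolding pp_pred_def by (metis pp_form.exhaust)
  from assms(2) obtain ys0 \<chi>s0 where 2: "pp_wf \<Gamma> (PP ys0 \<chi>s0)"
      "\<And>e. pp_sat \<Gamma> e (PP ys0 \<chi>s0) \<longleftrightarrow> Q e"
    unfolding pp_pred_def by (metis pp_form.exhaust)
  have fin: "finite ((\<Union>\<psi>\<in>set \<zeta>s. pp_atom_vars \<psi>) \<union> set zs)" for zs and \<zeta>s :: "'a pp_atom list"
    by simp
  from fin[of \<chi>s0 ys0] obtain M where M: "\<And>i. i \<in> (\<Union>\<psi>\<in>set \<chi>s0. pp_atom_vars \<psi>) \<union> set ys0 \<Longrightarrow> i < M"
    unfolding finite_nat_set_iff_bounded by blast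
  \<comment> \<open>The bound variables of the first formula move above all variables of the second;
    then those of the second move above all variables of the renamed first. No bound variable of one
    then occurs in the other.\<close>
  obtain xs \<psi>s where 3: "pp_wf \<Gamma> (PP xs \<psi>s)" "\<forall>x\<in>set xs. M \<le> x"
      "\<And>e. pp_sat \<Gamma> e (PP xs \<psi>s) \<longleftrightarrow> pp_sat \<Gamma> (e \<circ> id) (PP xs0 \<psi>s0)"
    using pp_rename_away[OF 1(1)] by metis
  from fin[of \<psi>s xs] obtain N where N: "\<And>i. i \<in> (\<Union>\<psi>\<in>set \<psi>s. pp_atom_vars \<psi>) \<union> set xs \<Longrightarrow> i < N"
    unfolding finite_nat_set_iff_bounded by blast
  obtain ys \<chi>s where 4: "pp_wf \<Gamma> (PP ys \<chi>s)" "\<forall>y\<in>set ys. N \<le> y"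
      "(\<Union>\<chi>\<in>set \<chi>s. pp_atom_vars \<chi>) \<subseteq> id ` (\<Union>\<psi>\<in>set \<chi>s0. pp_atom_vars \<psi>) \<union> set ys"
      "\<And>e. pp_sat \<Gamma> e (PP ys \<chi>s) \<longleftrightarrow> pp_sat \<Gamma> (e \<circ> id) (PP ys0 \<chi>s0)"
    by (rule pp_rename_away[OF 2(1), of N id]) blast
  have disj: "i \<notin> set ys" if "\<psi> \<in> set \<psi>s" "i \<in> pp_atom_vars \<psi>" for i \<psi>
    using that N 4(2) by fastforce
  have disj': "i \<notin> set xs" if "\<chi> \<in> set \<chi>s" "i \<in> pp_atom_vars \<chi>" for i \<chi>
  proof
    assume i: "i \<in> set xs"
    then have "i < N" using N by blast
    then have "i \<notin> set ys" using 4(2) by fastforce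
    then have "i < M" using 4(3) that M by auto
    then show False using i 3(2) by fastforce
  qed
  have "pp_sat \<Gamma> e (PP (xs @ ys) (\<psi>s @ \<chi>s)) \<longleftrightarrow> pp_sat \<Gamma> e (PP xs \<psi>s) \<and> pp_sat \<Gamma> e (PP ys \<chi>s)" for e
  proof
    assume "pp_sat \<Gamma> e (PP (xs @ ys) (\<psi>s @ \<chi>s))"
    then obtain d where d: "\<And>i. i \<notin> set xs \<Longrightarrow> i \<notin> set ys \<Longrightarrow> d i = e i"
        "\<And>\<psi>. \<psi> \<in> set \<psi>s \<Longrightarrow> pp_atom_sat \<Gamma> d \<psi>" "\<And>\<psi>. \<psi> \<in> set \<chi>s \<Longrightarrow> pp_atom_sat \<Gamma> d \<psi>"
      by auto
    define d1 where "d1 i = (if i \<in> set xs then d i else e i)" for i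
    define d2 where "d2 i = (if i \<in> set ys then d i else e i)" for i
    have "pp_atom_sat \<Gamma> d1 \<psi>" if "\<psi> \<in> set \<psi>s" for \<psi>
    proof -
      have "d1 i = d i" if "i \<in> pp_atom_vars \<psi>" for i
        using disj[OF \<open>\<psi> \<in> set \<psi>s\<close> that] d(1) by (auto simp: d1_def)
      then show ?thesis using d(2)[OF that] pp_atom_sat_cong by metis
    qed
    moreover have "pp_atom_sat \<Gamma> d2 \<chi>" if "\<chi> \<in> set \<chi>s" for \<chi>
    proof -
      have "d2 i = d i" if "i \<in> pp_atom_vars \<chi>" for i
        using disj'[OF \<open>\<chi> \<in> set \<chi>s\<close> that] d(1) by (auto simp: d2_def)
      then show ?thesis using d(3)[OF that] pp_atom_sat_cong by metis
    qed
    ultimately show "pp_sat \<Gamma> e (PP xs \<psi>s) \<and> pp_sat \<Gamma> e (PP ys \<chi>s)"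
      by (auto simp: d1_def d2_def intro: exI[of _ d1] exI[of _ d2])
  next
    assume "pp_sat \<Gamma> e (PP xs \<psi>s) \<and> pp_sat \<Gamma> e (PP ys \<chi>s)"
    then obtain d1 d2 where d1: "\<And>i. i \<notin> set xs \<Longrightarrow> d1 i = e i"
        "\<And>\<psi>. \<psi> \<in> set \<psi>s \<Longrightarrow> pp_atom_sat \<Gamma> d1 \<psi>"
      and d2: "\<And>i. i \<notin> set ys \<Longrightarrow> d2 i = e i"
        "\<And>\<psi>. \<psi> \<in> set \<chi>s \<Longrightarrow> pp_atom_sat \<Gamma> d2 \<psi>" unfolding pp_sat.simps by blast
    define d where "d i = (if i \<in> set xs then d1 i else d2 i)" for i
    have "pp_atom_sat \<Gamma> d \<psi>" if "\<psi> \<in> set \<psi>s" for \<psi>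
    proof -
      have "d i = d1 i" if "i \<in> pp_atom_vars \<psi>" for i
        using disj[OF \<open>\<psi> \<in> set \<psi>s\<close> that] d1(1) d2(1) by (auto simp: d_def)
      then show ?thesis using d1(2)[OF that] pp_atom_sat_cong by metis
    qed
    moreover have "pp_atom_sat \<Gamma> d \<chi>" if "\<chi> \<in> set \<chi>s" for \<chi>
    proof -
      have "d i = d2 i" if "i \<in> pp_atom_vars \<chi>" for i
        using disj'[OF \<open>\<chi> \<in> set \<chi>s\<close> that] by (auto simp: d_def)
      then show ?thesis using d2(2)[OF that] pp_atom_sat_cong by metis
    qed
    ultimately show "pp_sat \<Gamma> e (PP (xs @ ys) (\<psi>s @ \<chi>s))"
      using d1(1) d2(1) by (auto simp: d_def intro!: exI[of _ d])
  qed
  then have "pp_sat \<Gamma> e (PP (xs @ ys) (\<psi>s @ \<chi>s)) \<longleftrightarrow> P e \<and> Q e" for e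
    unfolding 3(3) 4(4) 1(2) 2(2) by simp
  moreover have "pp_wf \<Gamma> (PP (xs @ ys) (\<psi>s @ \<chi>s))" using 3(1) 4(1) by auto
  ultimately show ?thesis unfolding pp_pred_def by blast
qed

lemma pp_pred_exists:
  assumes "pp_pred \<Gamma> P" "finite X"
  shows "pp_pred \<Gamma> (\<lambda>e. \<exists>e'. (\<forall>i. i \<notin> X \<longrightarrow> e' i = e i) \<and> P e')"
proof -
  from assms(1) obtain xs \<psi>s where 1: "pp_wf \<Gamma> (PP xs \<psi>s)"
      "\<And>e. pp_sat \<Gamma> e (PP xs \<psi>s) \<longleftrightarrow> P e"
    unfolding pp_pred_def by (metis pp_form.exhaust)
  obtain ys where ys: "set ys = X" using finite_list[OF assms(2)] by blast
  have "pp_sat \<Gamma> e (PP (ys @ xs) \<psi>s) \<longleftrightarrow> (\<exists>e'. (\<forall>i. i \<notin> X \<longrightarrow> e' i = e i) \<and> P e')" for e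
  proof
    assume "pp_sat \<Gamma> e (PP (ys @ xs) \<psi>s)"
    then obtain d where d: "\<And>i. i \<notin> X \<Longrightarrow> i \<notin> set xs \<Longrightarrow> d i = e i"
        "\<forall>\<psi>\<in>set \<psi>s. pp_atom_sat \<Gamma> d \<psi>" using ys by auto
    define e' where "e' i = (if i \<in> X then d i else e i)" for i
    have "pp_sat \<Gamma> e' (PP xs \<psi>s)"
      using d by (auto simp: e'_def intro!: exI[of _ d])
    then show "\<exists>e'. (\<forall>i. i \<notin> X \<longrightarrow> e' i = e i) \<and> P e'"
      unfolding 1(2) by (intro exI[of _ e']) (simp add: e'_def)
  next
    assume "\<exists>e'. (\<forall>i. i \<notin> X \<longrightarrow> e' i = e i) \<and> P e'"
    then obtain e' where e': "\<And>i. i \<notin> X \<Longrightarrow> e' i = e i" "pp_sat \<Gamma> e' (PP xs \<psi>s)"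
      unfolding 1(2) by blast
    then show "pp_sat \<Gamma> e (PP (ys @ xs) \<psi>s)" using ys by auto metis
  qed
  moreover have "pp_wf \<Gamma> (PP (ys @ xs) \<psi>s)" using 1(1) by simp
  ultimately show ?thesis unfolding pp_pred_def by blast
qed

lemma pp_pred_Ball:
  "finite I \<Longrightarrow> (\<And>i. i \<in> I \<Longrightarrow> pp_pred \<Gamma> (P i)) \<Longrightarrow> pp_pred \<Gamma> (\<lambda>e. \<forall>i\<in>I. P i e)"
proof (induction I rule: finite_induct)
  case (insert i I)
  then have "pp_pred \<Gamma> (\<lambda>e. P i e \<and> (\<forall>i\<in>I. P i e))"
    by (intro pp_pred_conj) auto
  then show ?case by simp
qed (simp add: pp_pred_True)

text \<open>Free variables outside \<open>{..<k}\<close> are quantified as well, which does not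
  change the set of restrictions to the first \<open>k\<close> entries.\<close>

lemma pp_definable_if_pp_pred:
  assumes "pp_pred \<Gamma> P"
  shows "pp_definable \<Gamma> k {map e [0..<k] | e. P e}"
proof -
  from assms obtain xs \<psi>s where 1: "pp_wf \<Gamma> (PP xs \<psi>s)"
      "\<And>e. pp_sat \<Gamma> e (PP xs \<psi>s) \<longleftrightarrow> P e"
    unfolding pp_pred_def by (metis pp_form.exhaust)
  have "finite ((\<Union>\<psi>\<in>set \<psi>s. pp_atom_vars \<psi>) - {..<k})" by auto
  then obtain ys where ys: "set ys = (\<Union>\<psi>\<in>set \<psi>s. pp_atom_vars \<psi>) - {..<k}"
    using finite_list by metis
  define zs where "zs = ys @ xs"
  have "pp_wf \<Gamma> (PP zs \<psi>s)" using 1 by simp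
  moreover have "pp_free_vars (PP zs \<psi>s) \<subseteq> {..<k}"
    using ys by (auto simp: zs_def)
  moreover have "(\<exists>e. t = map e [0..<k] \<and> P e) \<longleftrightarrow> (\<exists>e. t = map e [0..<k] \<and> pp_sat \<Gamma> e (PP zs \<psi>s))" for t
  proof
    assume "\<exists>e. t = map e [0..<k] \<and> P e"
    then obtain e d where "t = map e [0..<k]" "\<And>i. i \<notin> set xs \<Longrightarrow> d i = e i"
        "\<forall>\<psi>\<in>set \<psi>s. pp_atom_sat \<Gamma> d \<psi>"
      unfolding 1(2)[symmetric] by auto
    then show "\<exists>e. t = map e [0..<k] \<and> pp_sat \<Gamma> e (PP zs \<psi>s)"
      by (intro exI[of _ e]) (auto simp: zs_def intro: exI[of _ d])
  next
    assume "\<exists>e. t = map e [0..<k] \<and> pp_sat \<Gamma> e (PP zs \<psi>s)"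
    then obtain e d where e: "t = map e [0..<k]" "\<And>i. i \<notin> set zs \<Longrightarrow> d i = e i"
        "\<forall>\<psi>\<in>set \<psi>s. pp_atom_sat \<Gamma> d \<psi>" by auto
    define e' where "e' i = (if i \<in> set ys then d i else e i)" for i
    have "pp_sat \<Gamma> e' (PP xs \<psi>s)"
      using e by (auto simp: e'_def zs_def intro!: exI[of _ d])
    moreover have "t = map e' [0..<k]"
      using e(1) ys by (auto simp: e'_def)
    ultimately show "\<exists>e. t = map e [0..<k] \<and> P e" unfolding 1(2) by blast
  qed
  ultimately show ?thesis unfolding pp_definable_def by blast
qed

lemma pp_pred_support:
  assumes "pp_pred \<Gamma> P"
  obtains N where "\<And>e e'. (\<And>i. i < N \<Longrightarrow> e i = e' i) \<Longrightarrow> P e \<longleftrightarrow> P e'"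
proof -
  from assms obtain xs \<psi>s where 1: "\<And>e. pp_sat \<Gamma> e (PP xs \<psi>s) \<longleftrightarrow> P e"
    unfolding pp_pred_def by (metis pp_form.exhaust)
  have "finite (\<Union>\<psi>\<in>set \<psi>s. pp_atom_vars \<psi>)" by simp
  then obtain N where N: "\<And>i. i \<in> (\<Union>\<psi>\<in>set \<psi>s. pp_atom_vars \<psi>) \<Longrightarrow> i < N"
    unfolding finite_nat_set_iff_bounded by blast
  have "pp_sat \<Gamma> e' (PP xs \<psi>s)"
    if agree: "\<And>i. i < N \<Longrightarrow> e i = e' i" and e: "pp_sat \<Gamma> e (PP xs \<psi>s)" for e e'
  proof -
    from e obtain d where d: "\<And>i. i \<notin> set xs \<Longrightarrow> d i = e i"
        "\<And>\<psi>. \<psi> \<in> set \<psi>s \<Longrightarrow> pp_atom_sat \<Gamma> d \<psi>"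
      by auto
    define d' where "d' i = (if i \<in> set xs then d i else e' i)" for i
    have "pp_atom_sat \<Gamma> d' \<psi>" if "\<psi> \<in> set \<psi>s" for \<psi>
    proof -
      have "d i = d' i" if "i \<in> pp_atom_vars \<psi>" for i
        using d(1) agree N that \<open>\<psi> \<in> set \<psi>s\<close> by (auto simp: d'_def)
      then show ?thesis using d(2)[OF that] pp_atom_sat_cong by metis
    qed
    then show ?thesis by (auto simp: d'_def intro: exI[of _ d'])
  qed
  from this[of e e' for e e'] this[of e' e for e e'] show ?thesis
    using that[of N] unfolding 1 by metis
qed

text \<open>Binding in the style of de Bruijn indices: variable 0 is bound, and variable
  \<open>i\<close> of the result is variable \<open>Suc i\<close> of \<open>P\<close>.\<close>

lemma pp_pred_ex:
  assumes "pp_pred \<Gamma> P"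
  shows "pp_pred \<Gamma> (\<lambda>e. \<exists>a. P (case_nat a e))"
proof -
  obtain N where N: "\<And>e e'. (\<And>i. i < N \<Longrightarrow> e i = e' i) \<Longrightarrow> P e \<longleftrightarrow> P e'"
    using pp_pred_support[OF assms] by blast
  have "pp_pred \<Gamma> (\<lambda>e. P (e \<circ> case_nat N id))"
    using assms by (rule pp_pred_rename)
  from pp_pred_exists[OF this, of "{N}"]
  have "pp_pred \<Gamma> (\<lambda>e. \<exists>e'. (\<forall>i. i \<noteq> N \<longrightarrow> e' i = e i) \<and> P (e' \<circ> case_nat N id))" by simp
  then show ?thesis
  proof (rule pp_pred_cong)
    fix e
    \<comment> \<open>\<open>P\<close> reads only positions below \<open>N\<close>; there position
      \<open>Suc i\<close> reads \<open>e' i\<close> with \<open>i < N\<close>, so a change at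
      \<open>N\<close> is seen at position 0 alone.\<close>
    have *: "P (e' \<circ> case_nat N id) \<longleftrightarrow> P (case_nat (e' N) e)" if "\<forall>i. i \<noteq> N \<longrightarrow> e' i = e i" for e'
      using that by (intro N) (auto split: nat.split)
    show "(\<exists>e'. (\<forall>i. i \<noteq> N \<longrightarrow> e' i = e i) \<and> P (e' \<circ> case_nat N id)) \<longleftrightarrow> (\<exists>a. P (case_nat a e))"
    proof
      assume "\<exists>a. P (case_nat a e)"
      then obtain a where "P (case_nat a e)" ..
      then show "\<exists>e'. (\<forall>i. i \<noteq> N \<longrightarrow> e' i = e i) \<and> P (e' \<circ> case_nat N id)"
        using *[of "e(N := a)"] by (intro exI[of _ "e(N := a)"]) auto
    qed (use * in blast)
  qed
qed

section \<open>Functions with primitive positive graph, and substitution\<close>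

text \<open>Index 0 holds the value and the arguments move up by one, matching the binder of
  \<open>pp_pred_ex\<close>.\<close>

definition pp_fun :: "'s rel_structure \<Rightarrow> ((nat \<Rightarrow> rat) \<Rightarrow> rat) \<Rightarrow> bool" where
  "pp_fun \<Gamma> u \<longleftrightarrow> pp_pred \<Gamma> (\<lambda>e. e 0 = u (\<lambda>i. e (Suc i)))"

lemma pp_fun_rename: "pp_fun \<Gamma> u \<Longrightarrow> pp_fun \<Gamma> (\<lambda>e. u (\<lambda>i. e (\<sigma> i)))"
  unfolding pp_fun_def
  by (drule pp_pred_rename[of _ _ "case_nat 0 (\<lambda>i. Suc (\<sigma> i))"]) simp

lemma pp_fun_var [intro]: "pp_fun \<Gamma> (\<lambda>e. e i)"
  unfolding pp_fun_def by (rule pp_pred_var_eq)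

text \<open>The value of \<open>u\<close> becomes a bound variable constrained by the graph of
  \<open>u\<close>, which allows exactly one witness.\<close>

lemma pp_pred_subst:
  assumes "pp_pred \<Gamma> (\<lambda>e. D (e 0) (\<lambda>i. e (Suc i)))" "pp_fun \<Gamma> u"
  shows "pp_pred \<Gamma> (\<lambda>e. D (u e) e)"
  using pp_pred_ex[OF pp_pred_conj[OF assms(2)[unfolded pp_fun_def] assms(1)]] by simp

lemma pp_pred_subst_upto:
  assumes "pp_pred \<Gamma> P" "\<And>i. i < n \<Longrightarrow> pp_fun \<Gamma> (U i)"
  shows "pp_pred \<Gamma> (\<lambda>e. P (\<lambda>i. if i < n then U i e else e (i - n)))"
  using assms(2)
proof (induction n arbitrary: U)
  case 0
  then show ?case using assms(1) by simp
next
  case (Suc n)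
  have eq: "(\<lambda>i. if i < n then U i e else case_nat (U n e) e (i - n)) =
      (\<lambda>i. if i < Suc n then U i e else e (i - Suc n))" for e
  proof
    fix i
    have "i - n = Suc (i - Suc n)" if "n < i" using that by simp
    then show "(if i < n then U i e else case_nat (U n e) e (i - n)) =
        (if i < Suc n then U i e else e (i - Suc n))"
      by (cases i n rule: linorder_cases) auto
  qed
  have eq': "case_nat (e 0) (\<lambda>i. e (Suc i)) = e" for e :: "nat \<Rightarrow> rat"
    by (rule ext) (simp split: nat.split)
  \<comment> \<open>In this instance of the induction hypothesis the functions ignore index 0, which
    therefore serves as position \<open>n\<close> and then receives \<open>U n\<close>.\<close>
  have "pp_pred \<Gamma> (\<lambda>e. P (\<lambda>i. if i < n then U i (\<lambda>i. e (Suc i)) else e (i - n)))"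
    by (rule Suc.IH) (rule pp_fun_rename, simp add: Suc.prems)
  then have "pp_pred \<Gamma> (\<lambda>e. P (\<lambda>i. if i < n then U i (\<lambda>i. e (Suc i))
      else case_nat (e 0) (\<lambda>i. e (Suc i)) (i - n)))"
    by (rule pp_pred_cong) (subst eq', rule refl)
  then have "pp_pred \<Gamma> (\<lambda>e. P (\<lambda>i. if i < n then U i e else case_nat (U n e) e (i - n)))"
    by (rule pp_pred_subst[where D = "\<lambda>a e. P (\<lambda>i. if i < n then U i e else case_nat a e (i - n))"])
      (use Suc.prems in simp)
  then show ?case unfolding eq .
qed

lemma pp_pred_rel_fun:
  assumes "\<And>i. i < arity \<Gamma> R \<Longrightarrow> pp_fun \<Gamma> (U i)"
  shows "pp_pred \<Gamma> (\<lambda>e. map (\<lambda>i. U i e) [0..<arity \<Gamma> R] \<in> interp \<Gamma> R)"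
proof -
  have pp: "pp_pred \<Gamma> (\<lambda>e. map e [0..<arity \<Gamma> R] \<in> interp \<Gamma> R)"
    by (rule pp_pred_rel) simp
  have eq: "map (\<lambda>i. if i < arity \<Gamma> R then U i e else e (i - arity \<Gamma> R)) [0..<arity \<Gamma> R] =
      map (\<lambda>i. U i e) [0..<arity \<Gamma> R]" for e
    by simp
  from pp_pred_subst_upto[OF pp, of "arity \<Gamma> R" U, OF assms] show ?thesis unfolding eq .
qed

lemma pp_pred_fun_eq:
  assumes "pp_fun \<Gamma> u" "pp_fun \<Gamma> v"
  shows "pp_pred \<Gamma> (\<lambda>e. u e = v e)"
  using pp_pred_subst[where D = "\<lambda>a e. a = v e", OF assms(2)[unfolded pp_fun_def] assms(1)] .

section \<open>Primitive positive definitions in expansions of \<open>(\<rat>; f)\<close>\<close>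

locale affine_structure =
  fixes \<Gamma> :: "'s rel_structure"
  assumes fo_expansion: "fo_expansion \<Gamma>"
begin

lemma pp_fun_f:
  assumes "pp_fun \<Gamma> u" "pp_fun \<Gamma> v" "pp_fun \<Gamma> w"
  shows "pp_fun \<Gamma> (\<lambda>e. f (u e) (v e) (w e))"
proof -
  obtain R where R: "arity \<Gamma> R = 4" "interp \<Gamma> R = {[a, b, c, d] | a b c d. f a b c = d}"
    using fo_expansion unfolding fo_expansion_def by blast
  define U where "U i = [\<lambda>e. u (\<lambda>i. e (Suc i)), \<lambda>e. v (\<lambda>i. e (Suc i)), \<lambda>e. w (\<lambda>i. e (Suc i)),
      \<lambda>e. e 0] ! i" for i
  have "pp_fun \<Gamma> (U i)" if "i < arity \<Gamma> R" for i
  proof -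
    from that R(1) have "i \<in> {0, 1, 2, 3}" by auto
    then show ?thesis using assms[THEN pp_fun_rename, of Suc] by (auto simp: U_def)
  qed
  from pp_pred_rel_fun[of \<Gamma> R U, OF this] show ?thesis
    unfolding pp_fun_def by (rule pp_pred_cong) (auto simp: R U_def upt_rec)
qed

lemma pp_fun_trm: "pp_fun \<Gamma> (\<lambda>e. trm_val e t)"
  by (induction t) (auto intro: pp_fun_f)

text \<open>For \<open>q = m / n\<close> the value y is the only solution of n (y - p) = m (u - v),
  an equation with integer coefficients; adding \<open>p\<close> to both sides turns them into
  terms.\<close>

lemma pp_fun_affine:
  assumes "pp_fun \<Gamma> p" "pp_fun \<Gamma> u" "pp_fun \<Gamma> v"
  shows "pp_fun \<Gamma> (\<lambda>e. p e + q * (u e - v e))"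
proof -
  obtain m n where mn: "quotient_of q = (m, n)" by fastforce
  then have q: "q = of_int m / of_int n" "n > 0"
    using quotient_of_div quotient_of_denom_pos by blast+
  define U where "U i = [\<lambda>e. e 0, \<lambda>e. p (\<lambda>i. e (Suc i)), \<lambda>e. u (\<lambda>i. e (Suc i)), \<lambda>e. v (\<lambda>i. e (Suc i))] ! i"
    for i
  have U: "pp_fun \<Gamma> (U i)" if "i < 4" for i
  proof -
    from that have "i \<in> {0, 1, 2, 3}" by auto
    then show ?thesis using assms[THEN pp_fun_rename, of Suc] by (auto simp: U_def)
  qed
  have "pp_pred \<Gamma> (\<lambda>e. trm_val e (add_multiple (Var 1) n (Var 0) (Var 1)) =
      trm_val e (add_multiple (Var 1) m (Var 2) (Var 3)))"
    by (intro pp_pred_fun_eq pp_fun_trm)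
  from pp_pred_subst_upto[OF this, of 4 U, OF U] show ?thesis
    unfolding pp_fun_def
    by (rule pp_pred_cong) (use q(2) in \<open>auto simp: U_def q(1) field_simps\<close>)
qed


lemma fo_definable: "fo_definable (arity \<Gamma> R) (interp \<Gamma> R)"
  using fo_expansion unfolding fo_expansion_def by blast

lemma pp_pred_neq:
  assumes "interp \<Gamma> R \<noteq> {}" "replicate (arity \<Gamma> R) 0 \<notin> interp \<Gamma> R"
  shows "pp_pred \<Gamma> (\<lambda>e. e 0 \<noteq> e 1)"
proof -
  define P where "P = (\<lambda>e. map e [0..<arity \<Gamma> R] \<in> interp \<Gamma> R)"
  from fo_definable[of R] obtain G where det: "determined_by G P"
    and R: "interp \<Gamma> R = {map e [0..<arity \<Gamma> R] | e. map e [0..<arity \<Gamma> R] \<in> interp \<Gamma> R}"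
    unfolding P_def by (rule fo_definable_determined)
  from R assms(1) obtain a where a: "P a" unfolding P_def by blast
  have "\<not> P (\<lambda>_. 0)" using assms(2) by (simp add: P_def map_replicate_const)
  \<comment> \<open>The hypothesis only excludes the zero tuple, but every equation holds at every
    constant assignment, so all constant tuples are excluded together.\<close>
  then have const: "\<not> P (\<lambda>_. c)" for c using determined_by_const[OF det] by blast
  have "P (\<lambda>i. x + a i * (y - x)) \<longleftrightarrow> x \<noteq> y" for x y
    using const[of x] determined_by_affine[OF det, of "y - x" x a] a
    by (cases "x = y") (auto simp: mult.commute)
  moreover have "pp_pred \<Gamma> (\<lambda>e. P (\<lambda>i. e 0 + a i * (e 1 - e 0)))"
    unfolding P_def by (intro pp_pred_rel_fun pp_fun_affine pp_fun_var)
  ultimately show ?thesis by simp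
qed

end

section \<open>From inequality to the disjunction of two equations\<close>

locale affine_structure_neq = affine_structure +
  assumes pp_pred_var_neq: "pp_pred \<Gamma> (\<lambda>e. e 0 \<noteq> e 1)"
begin

lemma pp_pred_fun_neq:
  assumes "pp_fun \<Gamma> u" "pp_fun \<Gamma> v"
  shows "pp_pred \<Gamma> (\<lambda>e. u e \<noteq> v e)"
  using pp_pred_subst_upto[OF pp_pred_var_neq, of 2 "\<lambda>i. if i = 0 then u else v"] assms by simp

text \<open>The set of all \<open>(l, m)\<close> with \<open>l * a + m * b \<in> R\<close> is a union of finitely many lines through the
  origin, with or without the origin, among them both axes. Scaling \<open>m\<close> by a generic \<open>c\<close> moves all
  lines except the axes, so intersecting with the scaled set leaves the axes only. The
  witnesses \<open>w\<close> and \<open>w'\<close> below make the origin irrelevant.\<close>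

lemma pp_pred_disj:
  assumes a: "map a [0..<arity \<Gamma> R] \<in> interp \<Gamma> R" and b: "map b [0..<arity \<Gamma> R] \<in> interp \<Gamma> R"
    and fin: "finite {m. map (\<lambda>i. a i + m * b i) [0..<arity \<Gamma> R] \<in> interp \<Gamma> R}"
  shows "pp_pred \<Gamma> (\<lambda>e. e 0 = e 1 \<or> e 2 = e 3)"
proof -
  define P where "P = (\<lambda>e. map e [0..<arity \<Gamma> R] \<in> interp \<Gamma> R)"
  from fo_definable[of R] obtain G where det: "determined_by G P"
    unfolding P_def by (rule fo_definable_determined)
  define M where "M = {m. P (\<lambda>i. a i + m * b i)}"
  have "finite M" using fin by (simp add: M_def P_def)
  \<comment> \<open>A generic factor: \<open>c\<close> is nonzero and not a quotient of elements of
    \<open>M\<close>, so \<open>m\<close> and \<open>c * m\<close> are both in \<open>M\<close> only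
    if \<open>m = 0\<close>.\<close>
  then have "finite (insert 0 ((\<lambda>(m, m'). m' / m) ` (M \<times> M)))" by simp
  then obtain c where c: "c \<notin> insert 0 ((\<lambda>(m, m'). m' / m) ` (M \<times> M))"
    using ex_new_if_finite infinite_UNIV_char_0 by blast
  have cM: "m = 0" if "m \<in> M" "c * m \<in> M" for m
  proof (rule ccontr)
    assume "m \<noteq> 0"
    then have "c = (\<lambda>(m, m'). m' / m) (m, c * m)" by simp
    then show False using c that by blast
  qed
  define T where "T l m \<longleftrightarrow> P (\<lambda>i. l * a i + m * b i)" for l m
  have T_l: "T l 0" if "l \<noteq> 0" for l
    using a determined_by_affine[OF det that, of 0 a] by (simp add: T_def P_def)
  have T_m: "T 0 m" if "m \<noteq> 0" for m
    using b determined_by_affine[OF det that, of 0 b] by (simp add: T_def P_def)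
  have T_M: "T l m \<longleftrightarrow> m / l \<in> M" if "l \<noteq> 0" for l m
    using determined_by_affine[OF det that, of 0 "\<lambda>i. a i + m / l * b i"] that
    by (simp add: T_def M_def distrib_left)
  have axes: "l = 0 \<or> m = 0" if "T l m" "T l (c * m)" for l m
    using cM[of "m / l"] that T_M by fastforce
  define D where "D l m \<longleftrightarrow> T l m \<and> T l (c * m)" for l m
  have D: "l = 0 \<or> m = 0 \<longleftrightarrow> (\<exists>w w'. D l w \<and> D m w' \<and> w + w' \<noteq> 0)" for l m
  proof
    have D_l: "D l 0" if "l \<noteq> 0" for l using T_l that by (simp add: D_def)
    have D_m: "D 0 m" if "m \<noteq> 0" for m using T_m that c by (simp add: D_def)
    assume "l = 0 \<or> m = 0"
    then consider "l = 0" "m = 0" | "l = 0" "m \<noteq> 0" | "l \<noteq> 0" "m = 0" by blast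
    then show "\<exists>w w'. D l w \<and> D m w' \<and> w + w' \<noteq> 0"
    proof cases
      case 1
      then show ?thesis using D_m[of 1] by (intro exI[of _ 1]) simp
    next
      case 2
      then show ?thesis using D_m[of 1] D_l[of m] by (intro exI[of _ 1] exI[of _ 0]) simp
    next
      case 3
      then show ?thesis using D_m[of 1] D_l[of l] by (intro exI[of _ 0] exI[of _ 1]) simp
    qed
  next
    assume "\<exists>w w'. D l w \<and> D m w' \<and> w + w' \<noteq> 0"
    then obtain w w' where "D l w" "D m w'" "w + w' \<noteq> 0" by blast
    then show "l = 0 \<or> m = 0" using axes[of l w] axes[of m w'] by (auto simp: D_def)
  qed
  \<comment> \<open>Relations are invariant under translation, so the arguments of \<open>T\<close>
    are encoded as differences from the base point \<open>e y\<close>.\<close>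
  have T: "pp_pred \<Gamma> (\<lambda>e. T (e x - e y) (d * (e w - e y)))" for x y w d
  proof -
    have "pp_pred \<Gamma> (\<lambda>e. P (\<lambda>i. (e y + a i * (e x - e y)) + (b i * d) * (e w - e y)))"
      unfolding P_def by (intro pp_pred_rel_fun pp_fun_affine pp_fun_var)
    then show ?thesis
    proof (rule pp_pred_cong)
      fix e
      show "P (\<lambda>i. (e y + a i * (e x - e y)) + (b i * d) * (e w - e y)) \<longleftrightarrow>
          T (e x - e y) (d * (e w - e y))"
        using determined_by_affine[OF det, of 1 "e y"
            "\<lambda>i. (e x - e y) * a i + d * (e w - e y) * b i"]
        by (simp add: T_def algebra_simps)
    qed
  qed
  have D_pp: "pp_pred \<Gamma> (\<lambda>e. D (e x - e y) (e w - e y))" for x y w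
    unfolding D_def using pp_pred_conj[OF T[of x y 1 w] T[of x y c w]] by simp
  \<comment> \<open>Indices 0 and 1 are the bound witnesses, shifted by the base points
    \<open>e 3\<close> and \<open>e 5\<close>; the inequality says that the two differences have a
    nonzero sum.\<close>
  have "pp_pred \<Gamma> (\<lambda>e. f (e 0) (e 3) (e 1) \<noteq> e 5)"
    by (intro pp_pred_fun_neq pp_fun_f pp_fun_var)
  from pp_pred_ex[OF pp_pred_ex[OF pp_pred_conj[OF D_pp[of 2 3 0] pp_pred_conj[OF D_pp[of 4 5 1] this]]]]
  show ?thesis
  proof (rule pp_pred_cong, goal_cases)
    case (1 e)
    have "(\<exists>w' w. D (e 0 - e 1) (w - e 1) \<and> D (e 2 - e 3) (w' - e 3) \<and> f w (e 1) w' \<noteq> e 3) \<longleftrightarrow>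
        (\<exists>w w'. D (e 0 - e 1) w \<and> D (e 2 - e 3) w' \<and> w + w' \<noteq> 0)"
    proof
      assume "\<exists>w' w. D (e 0 - e 1) (w - e 1) \<and> D (e 2 - e 3) (w' - e 3) \<and> f w (e 1) w' \<noteq> e 3"
      then obtain w w' where "D (e 0 - e 1) (w - e 1)" "D (e 2 - e 3) (w' - e 3)" "f w (e 1) w' \<noteq> e 3"
        by blast
      moreover from this(3) have "(w - e 1) + (w' - e 3) \<noteq> 0" by (auto simp: f_def)
      ultimately show "\<exists>w w'. D (e 0 - e 1) w \<and> D (e 2 - e 3) w' \<and> w + w' \<noteq> 0" by blast
    next
      assume "\<exists>w w'. D (e 0 - e 1) w \<and> D (e 2 - e 3) w' \<and> w + w' \<noteq> 0"
      then obtain w w' where "D (e 0 - e 1) w" "D (e 2 - e 3) w'" "w + w' \<noteq> 0" by blast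
      then show "\<exists>w' w. D (e 0 - e 1) (w - e 1) \<and> D (e 2 - e 3) (w' - e 3) \<and> f w (e 1) w' \<noteq> e 3"
        by (intro exI[of _ "w' + e 3"] exI[of _ "w + e 1"]) (auto simp: f_def)
    qed
    also have "\<dots> \<longleftrightarrow> e 0 = e 1 \<or> e 2 = e 3" using D[of "e 0 - e 1" "e 2 - e 3"] by simp
    finally show ?case by (simp add: numeral_eq_Suc)
  qed
qed

end

section \<open>Clauses and arbitrary first-order definable relations\<close>

locale affine_structure_disj = affine_structure_neq +
  assumes pp_pred_var_disj: "pp_pred \<Gamma> (\<lambda>e. e 0 = e 1 \<or> e 2 = e 3)"
begin

lemma pp_pred_fun_disj:
  assumes "pp_fun \<Gamma> s" "pp_fun \<Gamma> t" "pp_fun \<Gamma> u" "pp_fun \<Gamma> v"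
  shows "pp_pred \<Gamma> (\<lambda>e. s e = t e \<or> u e = v e)"
  using pp_pred_subst_upto[OF pp_pred_var_disj, of 4
      "\<lambda>i. if i = 0 then s else if i = 1 then t else if i = 2 then u else v"] assms by simp

text \<open>Primitive positive predicates are not closed under disjunction in general, so clauses
  are built literal by literal with this invariant, which leaves room for one more equation between
  two extra variables.\<close>

definition disjoinable :: "((nat \<Rightarrow> rat) \<Rightarrow> bool) \<Rightarrow> bool" where
  "disjoinable Q \<longleftrightarrow> pp_pred \<Gamma> (\<lambda>e. e 0 = e 1 \<or> Q (\<lambda>i. e (Suc (Suc i))))"

lemma disjoinable_rename: "disjoinable Q \<Longrightarrow> disjoinable (\<lambda>e. Q (\<lambda>i. e (\<sigma> i)))"
  unfolding disjoinable_def
  by (drule pp_pred_rename[of _ _ "case_nat 0 (case_nat 1 (\<lambda>i. Suc (Suc (\<sigma> i))))"]) simp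

lemma disjoinableD:
  assumes "disjoinable Q" "pp_fun \<Gamma> u" "pp_fun \<Gamma> v"
  shows "pp_pred \<Gamma> (\<lambda>e. u e = v e \<or> Q e)"
  using pp_pred_subst_upto[OF assms(1)[unfolded disjoinable_def], of 2 "\<lambda>i. if i = 0 then u else v"]
    assms(2,3) by simp

lemma disjoinable_False: "disjoinable (\<lambda>e. False)"
  unfolding disjoinable_def using pp_pred_var_eq[of \<Gamma> 0 1] by simp

text \<open>A chain through a new \<open>z\<close> splits \<open>x = y \<or> u = v \<or> Q\<close>
  into \<open>x = z \<or> u = v\<close> and \<open>z = y \<or> Q\<close>. If \<open>u = v\<close>
  and \<open>Q\<close> both fail, then \<open>x = z = y\<close>; conversely \<open>z\<close> is
  chosen as \<open>x\<close> or \<open>y\<close>.\<close>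

lemma disjoinable_eq:
  assumes "disjoinable Q" "pp_fun \<Gamma> u" "pp_fun \<Gamma> v"
  shows "disjoinable (\<lambda>e. u e = v e \<or> Q e)"
proof -
  let ?s = "\<lambda>e::nat \<Rightarrow> rat. \<lambda>i. e (Suc (Suc (Suc i)))"
  have "pp_pred \<Gamma> (\<lambda>e. e 0 = e 2 \<or> Q (?s e))"
    using disjoinableD[OF disjoinable_rename[OF assms(1)] pp_fun_var pp_fun_var] .
  moreover have "pp_pred \<Gamma> (\<lambda>e. e 1 = e 0 \<or> u (?s e) = v (?s e))"
    using pp_pred_fun_disj[OF pp_fun_var pp_fun_var assms(2,3)[THEN pp_fun_rename]] .
  ultimately have "pp_pred \<Gamma> (\<lambda>e. (e 0 = e 2 \<or> Q (?s e)) \<and> (e 1 = e 0 \<or> u (?s e) = v (?s e)))"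
    by (rule pp_pred_conj)
  from pp_pred_ex[OF this] show ?thesis
    unfolding disjoinable_def by (rule pp_pred_cong) (auto simp: numeral_eq_Suc)
qed

text \<open>A new \<open>z \<noteq> v\<close> replaces the negative literal: in
  \<open>x = y \<or> z = u \<or> Q\<close> the middle disjunct can hold only if
  \<open>u \<noteq> v\<close>, and if another disjunct holds, any \<open>z \<noteq> v\<close> will
  do.\<close>

lemma disjoinable_neq:
  assumes "disjoinable Q" "pp_fun \<Gamma> u" "pp_fun \<Gamma> v"
  shows "disjoinable (\<lambda>e. u e = v e \<longrightarrow> Q e)"
proof -
  let ?s = "\<lambda>e::nat \<Rightarrow> rat. \<lambda>i. e (Suc (Suc (Suc i)))"
  define Q' where "Q' e \<longleftrightarrow> e 0 = u (\<lambda>i. e (Suc i)) \<or> Q (\<lambda>i. e (Suc i))" for e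
  have "disjoinable Q'"
    unfolding Q'_def
    using disjoinable_eq[OF disjoinable_rename[OF assms(1)] pp_fun_var pp_fun_rename[OF assms(2)]] .
  \<comment> \<open>Index 0 of \<open>Q'\<close> is the new variable; the other indices skip places
    1 and 2, reserved for the two compared variables.\<close>
  then have "disjoinable (\<lambda>e. Q' (\<lambda>i. e (case_nat 0 (\<lambda>i. Suc (Suc (Suc i))) i)))"
    by (rule disjoinable_rename)
  then have "pp_pred \<Gamma> (\<lambda>e. e 1 = e 2 \<or> Q' (\<lambda>i. e (case_nat 0 (\<lambda>i. Suc (Suc (Suc i))) i)))"
    by (intro disjoinableD pp_fun_var)
  moreover have "pp_pred \<Gamma> (\<lambda>e. e 0 \<noteq> v (?s e))"
    using pp_pred_fun_neq[OF pp_fun_var pp_fun_rename[OF assms(3)]] .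
  ultimately have "pp_pred \<Gamma> (\<lambda>e. (e 1 = e 2 \<or> e 0 = u (?s e) \<or> Q (?s e)) \<and> e 0 \<noteq> v (?s e))"
    unfolding Q'_def by (auto dest: pp_pred_conj)
  from pp_pred_ex[OF this] show ?thesis
    unfolding disjoinable_def
  proof (rule pp_pred_cong, goal_cases)
    case (1 e)
    have "\<exists>x. x \<noteq> y" for y :: rat
      by (rule exI[of _ "y + 1"]) simp
    then show ?case
      by (auto simp: numeral_eq_Suc)
  qed
qed

lemma disjoinable_clause: "disjoinable (\<lambda>e. \<exists>l\<in>set C. lit_sat e l)"
proof (induction C)
  case Nil
  show ?case using disjoinable_False by simp
next
  case (Cons l C)
  then show ?case
    by (cases l) (simp_all add: disjoinable_eq disjoinable_neq pp_fun_trm)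
qed

lemma pp_pred_cnf: "pp_pred \<Gamma> (\<lambda>e. cnf_sat e \<Phi>)"
proof -
  have "pp_pred \<Gamma> (\<lambda>e. \<exists>l\<in>set C. lit_sat e l)" for C
  proof -
    \<comment> \<open>Two bound, distinct variables make the extra equation false, which leaves the
      clause.\<close>
    have "pp_pred \<Gamma> (\<lambda>e. e 0 \<noteq> e 1 \<and> (e 0 = e 1 \<or> (\<exists>l\<in>set C. lit_sat (\<lambda>i. e (Suc (Suc i))) l)))"
      using disjoinable_clause[of C] pp_pred_var_neq unfolding disjoinable_def
      by (intro pp_pred_conj)
    from pp_pred_ex[OF pp_pred_ex[OF this]] show ?thesis
    proof (rule pp_pred_cong, goal_cases)
      case (1 e)
      have "\<exists>x y. y \<noteq> (x::rat)" by (rule exI[of _ 0], rule exI[of _ 1]) simp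
      then show ?case by auto
    qed
  qed
  then show ?thesis unfolding cnf_sat_def by (intro pp_pred_Ball) auto
qed

lemma pp_definable_if_fo_definable:
  assumes "fo_definable k S"
  shows "pp_definable \<Gamma> k S"
proof -
  obtain G where G: "determined_by (set G) (\<lambda>e. map e [0..<k] \<in> S)"
    and S: "S = {map e [0..<k] | e. map e [0..<k] \<in> S}"
    by (rule fo_definable_determined[OF assms])
  from cnf_if_determined[OF G] obtain \<Phi>
    where \<Phi>: "\<forall>e. cnf_sat e \<Phi> \<longleftrightarrow> map e [0..<k] \<in> S" ..
  have "pp_pred \<Gamma> (\<lambda>e. map e [0..<k] \<in> S)"
    by (rule pp_pred_cong[OF pp_pred_cnf]) (rule \<Phi>[rule_format])
  from pp_definable_if_pp_pred[OF this, of k] show ?thesis using S by simp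
qed

end

section \<open>The trichotomy\<close>

lemma horn_definable_if_closed:
  assumes "fo_definable k R"
    and closed: "\<And>a b. map a [0..<k] \<in> R \<Longrightarrow> map b [0..<k] \<in> R \<Longrightarrow>
      infinite {m. map (\<lambda>i. a i + m * b i) [0..<k] \<in> R}"
  shows "horn_definable k R"
proof -
  obtain G where G: "\<And>g. g \<in> set G \<Longrightarrow> eq_vars g \<subseteq> {..<k}"
      "determined_by (set G) (\<lambda>e. map e [0..<k] \<in> R)"
    and R: "R = {map e [0..<k] | e. map e [0..<k] \<in> R}"
    by (rule fo_definable_determined[OF assms(1)]) (rule that; assumption)
  from horn_cnf_if_closed[OF G closed] obtain \<Phi> where
    \<Phi>: "horn \<Phi>" "cnf_vars \<Phi> \<subseteq> {..<k}" "\<And>e. cnf_sat e \<Phi> \<longleftrightarrow> map e [0..<k] \<in> R" by blast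
  have "R = {map e [0..<k] | e. cnf_sat e \<Phi>}" unfolding \<Phi>(3) by (rule R)
  with \<Phi>(1,2) show ?thesis unfolding horn_definable_def by blast
qed

theorem theorem5p5:
  fixes \<Gamma> :: "'s rel_structure"
  assumes "fo_expansion \<Gamma>"
  shows "(\<forall>R. horn_definable (arity \<Gamma> R) (interp \<Gamma> R)) \<or>
         (\<forall>R. interp \<Gamma> R \<noteq> {} \<longrightarrow> replicate (arity \<Gamma> R) 0 \<in> interp \<Gamma> R) \<or>
         (\<forall>k S. fo_definable k S \<longrightarrow> pp_definable \<Gamma> k S)"
proof -
  interpret affine_structure \<Gamma> by standard (rule assms)
  have "pp_definable \<Gamma> k S"
    if R: "\<not> horn_definable (arity \<Gamma> R) (interp \<Gamma> R)"
      and R': "interp \<Gamma> R' \<noteq> {}" "replicate (arity \<Gamma> R') 0 \<notin> interp \<Gamma> R'"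
      and S: "fo_definable k S" for R R' k S
  proof -
    interpret affine_structure_neq \<Gamma>
      by standard (rule pp_pred_neq[OF R'])
    \<comment> \<open>\<open>R'\<close>, a counterexample to (ii), gave inequality.
      \<open>R\<close>, a counterexample to (i), fails the closure condition for Horn definability,
      and the failing pair gives the disjunction.\<close>
    obtain a b where "map a [0..<arity \<Gamma> R] \<in> interp \<Gamma> R" "map b [0..<arity \<Gamma> R] \<in> interp \<Gamma> R"
      "finite {m. map (\<lambda>i. a i + m * b i) [0..<arity \<Gamma> R] \<in> interp \<Gamma> R}"
      using horn_definable_if_closed[OF fo_definable] R by blast
    then interpret affine_structure_disj \<Gamma>
      by unfold_locales (rule pp_pred_disj)
    show ?thesis using S by (rule pp_definable_if_fo_definable)
  qed
  then show ?thesis by blast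
qed

end
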